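(* Let $D\subseteq\mathbb{C}$ be open, let $\varphi_1,\varphi_2,\psi$ be analytic functions on $D$, let $\alpha,\beta\in\mathbb{R}^{+}\setminus\{1\}$, and for $n=0,1,2,\dots$ let $\Theta_n(x)=\alpha^{\varphi_1(x)}\frac{d^n}{dx^n}\left(\psi(x)\beta^{-\varphi_2(x)}\right)$. Let $s\in\mathbb{N}$, $p\in\mathbb{N}$, $\mu,\nu\in\mathbb{C}$, let $(a_k)_{k\ge 0}$ be a sequence of nonzero numbers, and let $\Omega_{\mu+\nu k}(y_1,\dots,y_s)$ $(k=0,1,2,\dots)$ be identically non-vanishing functions of $s$ complex variables (of complex order $\mu+\nu k$). Put $$\Lambda_{\mu,\nu}(y_1,\dots,y_s;z):=\sum_{k=0}^{\infty}a_k\,\Omega_{\mu+\nu k}(y_1,\dots,y_s)\,z^k$$ and, for $n=0,1,2,\dots$, $$\Phi_{n,p,\mu,\nu}(x;y_1,\dots,y_s;\zeta):=\sum_{k=0}^{[n/p]}\frac{a_k}{(n-pk)!}\,\Theta_{n-pk}(x)\,\Omega_{\mu+\nu k}(y_1,\dots,y_s)\,\zeta^k .$$ Then, for $x\in D$ and $t\neq 0$ with $|t|$ sufficiently small (depending on $x$), $$\sum_{n=0}^{\infty}\Phi_{n,p,\mu,\nu}\!\left(x;y_1,\dots,y_s;\frac{\eta}{t^p}\right)t^n=\alpha^{\varphi_1(x)}\,\psi(x+t)\,\beta^{-\varphi_2(x+t)}\,\Lambda_{\mu,\nu}(y_1,\dots,y_s;\eta),$$ provided that each member of this identity exists (i.e.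 the series on both sides converge).
   Context: For $c>0$ and $w\in\mathbb{C}$, $c^{w}=e^{w\ln c}$ with $\ln$ the real natural logarithm. $[n/p]$ denotes the integer part of $n/p$. The "order" of $\Omega$ is just the index: $\Omega_{\mu+\nu k}$, $k\ge0$, is a family of functions indexed by the numbers $\mu+\nu k$. *)

theory Defs
  imports "HOL-Analysis.Analysis"
begin

text \<open>
  For a real base \<open>c > 0\<close>, the complex power \<open>of_real c powr w\<close> is \<open>exp (w * of_real (ln c))\<close>,
  with the real logarithm.
\<close>

definition Theta ::
  "real \<Rightarrow> real \<Rightarrow> (complex \<Rightarrow> complex) \<Rightarrow> (complex \<Rightarrow> complex) \<Rightarrow> (complex \<Rightarrow> complex) \<Rightarrow>
   nat \<Rightarrow> complex \<Rightarrow> complex" where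
  "Theta \<alpha> \<beta> \<phi>1 \<phi>2 \<psi> n x =
     (of_real \<alpha> powr \<phi>1 x) * (deriv ^^ n) (\<lambda>u. \<psi> u * (of_real \<beta> powr (- \<phi>2 u))) x"

definition Lambda_term ::
  "(nat \<Rightarrow> complex) \<Rightarrow> (complex \<Rightarrow> complex ^ 's \<Rightarrow> complex) \<Rightarrow> complex \<Rightarrow> complex \<Rightarrow>
   complex ^ 's \<Rightarrow> complex \<Rightarrow> nat \<Rightarrow> complex" where
  "Lambda_term a \<Omega> \<mu> \<nu> y z k = a k * \<Omega> (\<mu> + \<nu> * of_nat k) y * z ^ k"

text \<open>This is the intended function only where \<open>Lambda_term a \<Omega> \<mu> \<nu> y z\<close> is summable.\<close>

definition Lambda ::
  "(nat \<Rightarrow> complex) \<Rightarrow> (complex \<Rightarrow> complex ^ 's \<Rightarrow> complex) \<Rightarrow> complex \<Rightarrow> complex \<Rightarrow>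
   complex ^ 's \<Rightarrow> complex \<Rightarrow> complex" where
  "Lambda a \<Omega> \<mu> \<nu> y z = (\<Sum>k. Lambda_term a \<Omega> \<mu> \<nu> y z k)"

text \<open>The first argument is the sequence of functions \<open>\<Theta>\<^sub>0, \<Theta>\<^sub>1, \<dots>\<close>.\<close>

definition Phi ::
  "(nat \<Rightarrow> complex \<Rightarrow> complex) \<Rightarrow> (nat \<Rightarrow> complex) \<Rightarrow> (complex \<Rightarrow> complex ^ 's \<Rightarrow> complex) \<Rightarrow>
   nat \<Rightarrow> nat \<Rightarrow> complex \<Rightarrow> complex \<Rightarrow> complex \<Rightarrow> complex ^ 's \<Rightarrow> complex \<Rightarrow> complex" where
  "Phi \<Theta> a \<Omega> n p \<mu> \<nu> x y \<zeta> =
     (\<Sum>k = 0..n div p. a k / fact (n - p * k) * \<Theta> (n - p * k) x * \<Omega> (\<mu> + \<nu> * of_nat k) y * \<zeta> ^ k)"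

end

theory Submission
  imports Defs "HOL-Complex_Analysis.Cauchy_Integral_Formula"
begin

text \<open>
  Since \<open>(\<eta> / t ^ p) ^ k * t ^ n = \<eta> ^ k * t ^ (n - p * k)\<close>, the left-hand series is a Cauchy product
  of the Taylor series of \<open>\<psi> * \<beta> powr (- \<phi>2)\<close> at \<open>x\<close>, evaluated at \<open>x + t\<close>, with the series of
  \<open>\<Lambda>\<close> spread out over the multiples of \<open>p\<close>. The Taylor series converges absolutely while the
  series of \<open>\<Lambda>\<close> may converge only conditionally, so Mertens' theorem is needed; it follows from
  Tannery's theorem because the \<open>N\<close>-th partial sum of the product is
  \<open>\<Sum>m\<le>N. c m * B ((N - m) div p)\<close>, with \<open>B\<close> the bounded partial sums of the other factor.
\<close>

lemma sum_Cauchy_product_step: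
  fixes b c :: "nat \<Rightarrow> 'a::semiring_0"
  assumes "p \<ge> 1"
  shows "(\<Sum>n\<le>N. \<Sum>k\<le>n div p. c (n - p * k) * b k) = (\<Sum>m\<le>N. c m * (\<Sum>k\<le>(N - m) div p. b k))"
proof -
  have div_iff: "k \<le> n div p \<longleftrightarrow> p * k \<le> n" for k n
    using assms by (simp add: less_eq_div_iff_mult_less_eq mult.commute)
  have "(\<Sum>n\<le>N. \<Sum>k\<le>n div p. c (n - p * k) * b k)
      = (\<Sum>(n, k)\<in>(SIGMA n:{..N}. {..n div p}). c (n - p * k) * b k)"
    by (simp add: sum.Sigma)
  \<comment> \<open>The substitution \<open>m = n - p * k\<close> maps the region p * k \<le> n
    \<le> N bijectively onto m + p * k \<le> N. The subtraction never truncates there.\<close>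
  also have "\<dots> = (\<Sum>(m, k)\<in>(SIGMA m:{..N}. {..(N - m) div p}). c m * b k)"
    by (rule sum.reindex_bij_witness[where i = "\<lambda>(m, k). (m + p * k, k)"
          and j = "\<lambda>(n, k). (n - p * k, k)"]) (auto simp: div_iff)
  also have "\<dots> = (\<Sum>m\<le>N. c m * (\<Sum>k\<le>(N - m) div p. b k))"
    by (simp add: sum.Sigma sum_distrib_left)
  finally show ?thesis .
qed

text \<open>For \<open>p = 1\<close> this is the classical Mertens theorem. A general
  \<open>p\<close> amounts to placing \<open>b k\<close> at index \<open>p * k\<close>, which
  repeats each partial sum of \<open>b\<close> in blocks of length \<open>p\<close> and so keeps its
  limit.\<close>

lemma Mertens_step_sums:
  fixes b c :: "nat \<Rightarrow> 'a::{real_normed_algebra, banach}"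
  assumes "p \<ge> 1" and c: "summable (\<lambda>n. norm (c n))" and b: "summable b"
  shows "(\<lambda>n. \<Sum>k\<le>n div p. c (n - p * k) * b k) sums (suminf c * suminf b)"
proof -
  define B where "B n = (\<Sum>k\<le>n. b k)" for n
  \<comment> \<open>Extending by zero beyond \<open>N\<close> turns the partial sum into a series
    whose index range does not depend on \<open>N\<close>, as Tannery's theorem requires.\<close>
  define f where "f m N = (if m \<le> N then c m * B ((N - m) div p) else 0)" for m N
  have B_lim: "B \<longlonglongrightarrow> suminf b"
    unfolding B_def using summable_LIMSEQ'[OF b] .
  then have "Bseq B"
    by (intro convergent_imp_Bseq convergentI)
  then obtain K where K: "\<And>n. norm (B n) \<le> K"
    by (auto simp: Bseq_def)
  have "K \<ge> 0"
    using K[of 0] norm_ge_zero order_trans by blast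
  have f_lim: "(\<lambda>N. f m N) \<longlonglongrightarrow> c m * suminf b" for m
  proof -
    have "filterlim (\<lambda>N. (N - m) div p) at_top sequentially"
      unfolding filterlim_at_top eventually_sequentially
    proof (intro allI exI impI)
      fix Z N :: nat
      assume "Z * p + m \<le> N"
      then show "Z \<le> (N - m) div p"
        using assms(1) by (simp add: less_eq_div_iff_mult_less_eq)
    qed
    then have "(\<lambda>N. c m * B ((N - m) div p)) \<longlonglongrightarrow> c m * suminf b"
      by (intro tendsto_mult_left filterlim_compose[OF B_lim])
    moreover have "eventually (\<lambda>N. c m * B ((N - m) div p) = f m N) sequentially"
      using eventually_ge_at_top[of m] by eventually_elim (simp add: f_def)
    ultimately show ?thesis
      by (rule Lim_transform_eventually)
  qed
  \<comment> \<open>This majorant is independent of \<open>N\<close>, and it is summable in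
    \<open>m\<close> because \<open>c\<close> converges absolutely; of \<open>b\<close> it uses only
    bounded partial sums.\<close>
  have f_bound: "norm (f m N) \<le> norm (c m) * K" for m N
    using K \<open>K \<ge> 0\<close> by (auto simp: f_def intro!: order_trans[OF norm_mult_ineq] mult_left_mono)
  then have "eventually (\<lambda>(m, N). norm (f m N) \<le> norm (c m) * K) (at_top \<times>\<^sub>F sequentially)"
    by (intro always_eventually) auto
  then have "(\<lambda>N. suminf (\<lambda>m. f m N)) \<longlonglongrightarrow> suminf (\<lambda>m. c m * suminf b)"
    using tannerys_theorem[OF f_lim _ summable_mult2[OF c]] by simp
  moreover have "suminf (\<lambda>m. f m N) = (\<Sum>n\<le>N. \<Sum>k\<le>n div p. c (n - p * k) * b k)" for N
  proof -
    have "suminf (\<lambda>m. f m N) = (\<Sum>m\<le>N. f m N)"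
      by (rule suminf_finite) (auto simp: f_def)
    also have "\<dots> = (\<Sum>m\<le>N. c m * B ((N - m) div p))"
      by (simp add: f_def)
    finally show ?thesis
      by (simp add: B_def sum_Cauchy_product_step[OF assms(1)])
  qed
  moreover have "suminf (\<lambda>m. c m * suminf b) = suminf c * suminf b"
    using summable_norm_cancel[OF c] by (rule suminf_mult2[symmetric])
  ultimately show ?thesis
    by (simp add: sums_def_le)
qed

text \<open>A power series that converges at one point converges absolutely at every point strictly
  closer to the centre. The Taylor series converges at \<open>z + of_real s\<close> for any
  \<open>s\<close> strictly between \<open>cmod (w - z)\<close> and \<open>r\<close>.\<close>

lemma holomorphic_Taylor_abs_summable:
  assumes "f holomorphic_on ball z r" and "w \<in> ball z r"
  shows "summable (\<lambda>n. norm ((deriv ^^ n) f z / fact n * (w - z) ^ n))"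
proof -
  obtain s where s: "cmod (w - z) < s" "s < r"
    using assms(2) dense by (auto simp: dist_norm norm_minus_commute)
  then have "s > 0"
    using norm_ge_zero le_less_trans by blast
  then have "z + of_real s \<in> ball z r"
    using s by (simp add: dist_norm)
  then have "summable (\<lambda>n. (deriv ^^ n) f z / fact n * of_real s ^ n)"
    using holomorphic_power_series[OF assms(1)] by (fastforce simp: sums_iff)
  then show ?thesis
    by (rule powser_insidea) (use s \<open>s > 0\<close> in simp)
qed

theorem theorem8:
  fixes D :: "complex set"
    and \<phi>1 \<phi>2 \<psi> :: "complex \<Rightarrow> complex"
    and \<alpha> \<beta> :: real
    and p :: nat
    and \<mu> \<nu> :: complex
    and a :: "nat \<Rightarrow> complex"
    and \<Omega> :: "complex \<Rightarrow> complex ^ 's \<Rightarrow> complex"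
    and x :: complex
  assumes "open D"
    and "\<phi>1 analytic_on D" and "\<phi>2 analytic_on D" and "\<psi> analytic_on D"
    and "\<alpha> > 0" and "\<alpha> \<noteq> 1" and "\<beta> > 0" and "\<beta> \<noteq> 1"
    and "p \<ge> 1"
    and "\<And>k. a k \<noteq> 0"
    and "\<And>k::nat. \<exists>y. \<Omega> (\<mu> + \<nu> * of_nat k) y \<noteq> 0"
    and "x \<in> D"
  shows "\<exists>r>0. ball x r \<subseteq> D \<and>
    (\<forall>t y \<eta>. t \<noteq> 0 \<longrightarrow> cmod t < r \<longrightarrow>
       summable (\<lambda>n. Phi (Theta \<alpha> \<beta> \<phi>1 \<phi>2 \<psi>) a \<Omega> n p \<mu> \<nu> x y (\<eta> / t ^ p) * t ^ n) \<longrightarrow>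
       summable (Lambda_term a \<Omega> \<mu> \<nu> y \<eta>) \<longrightarrow>
       (\<Sum>n. Phi (Theta \<alpha> \<beta> \<phi>1 \<phi>2 \<psi>) a \<Omega> n p \<mu> \<nu> x y (\<eta> / t ^ p) * t ^ n) =
         (of_real \<alpha> powr \<phi>1 x) * \<psi> (x + t) * (of_real \<beta> powr (- \<phi>2 (x + t))) * Lambda a \<Omega> \<mu> \<nu> y \<eta>)"
proof -
  define g where "g u = \<psi> u * (of_real \<beta> powr (- \<phi>2 u))" for u
  \<comment> \<open>Any ball around \<open>x\<close> inside \<open>D\<close> will do: the radius
    serves only the Taylor expansion at \<open>x\<close>, so it is independent of \<open>y\<close>
    and \<eta>.\<close>
  obtain r where r: "r > 0" "ball x r \<subseteq> D"
    using \<open>open D\<close> \<open>x \<in> D\<close> open_contains_ball by blast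
  \<comment> \<open>The base is a positive constant, so it stays off the branch cut of the
    logarithm.\<close>
  have "g analytic_on D"
    unfolding g_def using assms by (intro analytic_intros) auto
  then have g: "g holomorphic_on ball x r"
    using r(2) analytic_imp_holomorphic holomorphic_on_subset by blast
  have "(\<Sum>n. Phi (Theta \<alpha> \<beta> \<phi>1 \<phi>2 \<psi>) a \<Omega> n p \<mu> \<nu> x y (\<eta> / t ^ p) * t ^ n)
      = (of_real \<alpha> powr \<phi>1 x) * \<psi> (x + t) * (of_real \<beta> powr (- \<phi>2 (x + t))) * Lambda a \<Omega> \<mu> \<nu> y \<eta>"
    if "t \<noteq> 0" "cmod t < r" and b: "summable (Lambda_term a \<Omega> \<mu> \<nu> y \<eta>)" for t y \<eta>
  proof -
    define A where "A = (of_real \<alpha> :: complex) powr \<phi>1 x"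
    define c where "c n = (deriv ^^ n) g x / fact n * t ^ n" for n
    have xt: "x + t \<in> ball x r"
      using that by (simp add: dist_norm)
    have "c sums g (x + t)"
      using holomorphic_power_series[OF g xt] by (simp add: c_def[abs_def])
    then have c_sum: "suminf c = g (x + t)"
      by (simp add: sums_iff)
    have c_abs: "summable (\<lambda>n. norm (c n))"
      using holomorphic_Taylor_abs_summable[OF g xt] by (simp add: c_def)
    have "Phi (Theta \<alpha> \<beta> \<phi>1 \<phi>2 \<psi>) a \<Omega> n p \<mu> \<nu> x y (\<eta> / t ^ p) * t ^ n
        = A * (\<Sum>k\<le>n div p. c (n - p * k) * Lambda_term a \<Omega> \<mu> \<nu> y \<eta> k)" for n
      unfolding Phi_def sum_distrib_left sum_distrib_right atLeast0AtMost
    proof (rule sum.cong[OF refl])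
      fix k assume "k \<in> {..n div p}"
      \<comment> \<open>This guards against truncated subtraction: it gives n = p * k + (n - p * k),
        so the power of \<open>t\<close> can be split and its first factor cancelled.\<close>
      then have "p * k \<le> n"
        using \<open>p \<ge> 1\<close> by (simp add: less_eq_div_iff_mult_less_eq mult.commute)
      then have "t ^ n = t ^ (p * k) * t ^ (n - p * k)"
        by (simp flip: power_add)
      then have "(\<eta> / t ^ p) ^ k * t ^ n = \<eta> ^ k * t ^ (n - p * k)"
        using \<open>t \<noteq> 0\<close> by (simp add: power_divide power_mult)
      moreover have "Theta \<alpha> \<beta> \<phi>1 \<phi>2 \<psi> m x = A * (deriv ^^ m) g x" for m
        by (simp add: Theta_def A_def g_def[abs_def])
      ultimately show "a k / fact (n - p * k) * Theta \<alpha> \<beta> \<phi>1 \<phi>2 \<psi> (n - p * k) x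
          * \<Omega> (\<mu> + \<nu> * of_nat k) y * (\<eta> / t ^ p) ^ k * t ^ n
        = A * (c (n - p * k) * Lambda_term a \<Omega> \<mu> \<nu> y \<eta> k)"
        by (simp add: c_def Lambda_term_def mult.assoc)
    qed
    then have "(\<lambda>n. Phi (Theta \<alpha> \<beta> \<phi>1 \<phi>2 \<psi>) a \<Omega> n p \<mu> \<nu> x y (\<eta> / t ^ p) * t ^ n)
        sums (A * (g (x + t) * Lambda a \<Omega> \<mu> \<nu> y \<eta>))"
      using sums_mult[OF Mertens_step_sums[OF \<open>p \<ge> 1\<close> c_abs b], of A]
      by (simp add: c_sum Lambda_def)
    then show ?thesis
      by (simp add: sums_iff A_def g_def mult.assoc)
  qed
  then show ?thesis
    using r by blast
qed

end
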